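(* Let $\mathcal{A}=\mathcal{U}-\mathcal{V}$ be a sub-proper splitting of a tensor $\mathcal{A}\in\mathbb{C}^{I_{1}\times\cdots\times I_{M}\times J_{1}\times\cdots\times J_{N}}$. Then $\mathcal{A}=\mathcal{U}*_N(\mathcal{I}-\mathcal{U}^{\dagger}*_M\mathcal{V})$. Further, if $1$ is not an eigenvalue of $\mathcal{U}^{\dagger}*_M\mathcal{V}$, then: 1. $\mathcal{A}^{\dagger}=(\mathcal{I}-\mathcal{U}^{\dagger}*_M\mathcal{V})^{-1}*_N\mathcal{U}^{\dagger}$; 2. for $\mathcal{B}\in\mathbb{C}^{I_1\times\cdots\times I_M}$, if the system $\mathcal{A}*_N\mathcal{X}=\mathcal{B}$ (with unknown $\mathcal{X}\in\mathbb{C}^{J_1\times\cdots\times J_N}$) is consistent, then every solution $\mathcal{X}$ satisfying $\mathcal{U}^{\dagger}*_M\mathcal{U}*_N\mathcal{X}=\mathcal{X}$ satisfies $\mathcal{X}=\mathcal{U}^{\dagger}*_M\mathcal{V}*_N\mathcal{X}+\mathcal{U}^{\dagger}*_M\mathcal{B}$; and at least one such solution exists, e.g. $\mathcal{X}=\mathcal{A}^{\dagger}*_M\mathcal{B}$.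
   Context: Sub-proper splitting: a splitting $\mathcal{A}=\mathcal{U}-\mathcal{V}$ of $\mathcal{A}\in\mathbb{C}^{I_1\times\cdots\times I_M\times J_1\times\cdots\times J_N}$ (with $\mathcal{U},\mathcal{V}$ in the same tensor space) is called sub-proper if $\mathcal{U}*_N\mathcal{U}^{\dagger}*_M\mathcal{A}=\mathcal{A}$ and $\mathcal{A}*_N\mathcal{U}^{\dagger}*_M\mathcal{U}=\mathcal{A}$. Einstein product: for $\mathcal{A}\in\mathbb{C}^{I_1\times\cdots\times I_M\times J_1\times\cdots\times J_N}$ and $\mathcal{B}\in\mathbb{C}^{J_1\times\cdots\times J_N\times K_1\times\cdots\times K_L}$, $(\mathcal{A}*_N\mathcal{B})_{i_1\cdots i_Mk_1\cdots k_L}=\sum_{j_1,\dots,j_N}a_{i_1\cdots i_Mj_1\cdots j_N}b_{j_1\cdots j_Nk_1\cdots k_L}$ (if the second factor lies in $\mathbb{C}^{J_1\times\cdots\times J_N}$, the $k$-indices are absent). Conjugate transpose: $(\mathcal{A}^H)_{j_1\cdots j_Ni_1\cdots i_M}=\overline{a_{i_1\cdots i_Mj_1\cdots j_N}}$. Moore--Penrose inverse: for $\mathcal{X}\in\mathbb{C}^{I_1\times\cdots\times I_M\times J_1\times\cdots\times J_N}$, $\mathcal{X}^\dagger$ is the unique $\mathcal{Y}\in\mathbb{C}^{J_1\times\cdots\times J_N\times I_1\times\cdots\times I_M}$ with (1) $\mathcal{X}*_N\mathcal{Y}*_M\mathcal{X}=\mathcal{X}$, (2) $\mathcal{Y}*_M\mathcal{X}*_N\mathcal{Y}=\mathcal{Y}$,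 (3) $(\mathcal{X}*_N\mathcal{Y})^H=\mathcal{X}*_N\mathcal{Y}$, (4) $(\mathcal{Y}*_M\mathcal{X})^H=\mathcal{Y}*_M\mathcal{X}$. $\mathcal{I}\in\mathbb{C}^{J_1\times\cdots\times J_N\times J_1\times\cdots\times J_N}$ is the identity tensor, with entries $\prod_{k=1}^{N}\delta_{i_kj_k}$, and $\mathcal{C}^{-1}$ denotes the two-sided inverse of $\mathcal{C}\in\mathbb{C}^{J_1\times\cdots\times J_N\times J_1\times\cdots\times J_N}$ with respect to $*_N$. A scalar $\lambda\in\mathbb{C}$ is an eigenvalue of such a $\mathcal{C}$ if $\mathcal{C}*_N\mathcal{Z}=\lambda\mathcal{Z}$ for some nonzero $\mathcal{Z}\in\mathbb{C}^{J_1\times\cdots\times J_N}$. *)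

theory Defs
  imports Complex_Main
begin

text \<open>
  A tensor of shape \<open>ds = [d\<^sub>1, \<dots>, d\<^sub>n]\<close> assigns a complex number to every multi-index in
  \<open>{0..<d\<^sub>1} \<times> \<dots> \<times> {0..<d\<^sub>n}\<close> (counting from 0). Multi-indices are lists; entries outside the
  index range are fixed to 0, so that equality of tensors is equality of shapes and of all entries.
\<close>

definition multi_indices :: "nat list \<Rightarrow> nat list set" where
  "multi_indices ds = {is. length is = length ds \<and> (\<forall>k<length ds. is ! k < ds ! k)}"

typedef tensor = "{(ds :: nat list, f :: nat list \<Rightarrow> complex). \<forall>is. is \<notin> multi_indices ds \<longrightarrow> f is = 0}"
  by (intro exI[of _ "([], \<lambda>_. 0)"]) simp

definition shape :: "tensor \<Rightarrow> nat list" where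
  "shape A = fst (Rep_tensor A)"

definition entry :: "tensor \<Rightarrow> nat list \<Rightarrow> complex" where
  "entry A = snd (Rep_tensor A)"

definition mk_tensor :: "nat list \<Rightarrow> (nat list \<Rightarrow> complex) \<Rightarrow> tensor" where
  "mk_tensor ds f = Abs_tensor (ds, \<lambda>is. if is \<in> multi_indices ds then f is else 0)"

lemma Rep_mk_tensor:
  "Rep_tensor (mk_tensor ds f) = (ds, \<lambda>is. if is \<in> multi_indices ds then f is else 0)"
  unfolding mk_tensor_def by (rule Abs_tensor_inverse) simp

lemma shape_mk_tensor [simp]: "shape (mk_tensor ds f) = ds"
  by (simp add: shape_def Rep_mk_tensor)

lemma entry_mk_tensor: "entry (mk_tensor ds f) is = (if is \<in> multi_indices ds then f is else 0)"
  by (simp add: entry_def Rep_mk_tensor)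

lemma entry_outside: "is \<notin> multi_indices (shape A) \<Longrightarrow> entry A is = 0"
  using Rep_tensor[of A] by (auto simp: entry_def shape_def split_beta)

lemma tensor_eqI:
  assumes "shape A = shape B"
    and "\<And>is. is \<in> multi_indices (shape A) \<Longrightarrow> entry A is = entry B is"
  shows "A = B"
proof -
  have "entry A = entry B"
    using assms by (metis entry_outside ext)
  with assms(1) show ?thesis
    by (metis Rep_tensor_inject entry_def prod.collapse shape_def)
qed

definition tensor_space :: "nat list \<Rightarrow> tensor set" where
  "tensor_space ds = {A. shape A = ds}"

text \<open>Sums and differences are meant for tensors of equal shape only.\<close>

instantiation tensor :: "{plus, minus}"
begin

definition plus_tensor :: "tensor \<Rightarrow> tensor \<Rightarrow> tensor" where
  "A + B = mk_tensor (shape A) (\<lambda>is. entry A is + entry B is)"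

definition minus_tensor :: "tensor \<Rightarrow> tensor \<Rightarrow> tensor" where
  "A - B = mk_tensor (shape A) (\<lambda>is. entry A is - entry B is)"

instance ..

end

definition tensor_scale :: "complex \<Rightarrow> tensor \<Rightarrow> tensor" where
  "tensor_scale c A = mk_tensor (shape A) (\<lambda>is. c * entry A is)"

definition zero_tensor :: "nat list \<Rightarrow> tensor" where
  "zero_tensor ds = mk_tensor ds (\<lambda>_. 0)"

text \<open>
  The Einstein product contracts the last \<open>N\<close> indices of \<open>A\<close> with the first \<open>N\<close> indices of \<open>B\<close>;
  it is meant for tensors for which the corresponding dimensions agree. If \<open>B\<close> has order
  exactly \<open>N\<close>, no indices of \<open>B\<close> remain.
\<close>

definition einstein :: "tensor \<Rightarrow> nat \<Rightarrow> tensor \<Rightarrow> tensor" ("_ \<star>\<^bsub>_\<^esub> _" [70, 0, 71] 70) where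
  "A \<star>\<^bsub>N\<^esub> B =
     (let m = length (shape A) - N in
      mk_tensor (take m (shape A) @ drop N (shape B))
        (\<lambda>is. \<Sum>js\<in>multi_indices (take N (shape B)).
           entry A (take m is @ js) * entry B (js @ drop m is)))"

text \<open>
  In the remaining notions, \<open>M\<close> is the number of leading (row) indices of a tensor
  in \<open>\<complex>\<^bsup>I\<^sub>1 \<times> \<dots> \<times> I\<^sub>M \<times> J\<^sub>1 \<times> \<dots> \<times> J\<^sub>N\<^esup>\<close>, and \<open>N\<close> the number of its trailing (column) indices.
\<close>

definition conj_transpose :: "nat \<Rightarrow> nat \<Rightarrow> tensor \<Rightarrow> tensor" where
  "conj_transpose M N A =
     mk_tensor (drop M (shape A) @ take M (shape A))
       (\<lambda>is. cnj (entry A (drop N is @ take N is)))"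

definition is_mp_inverse :: "nat \<Rightarrow> nat \<Rightarrow> tensor \<Rightarrow> tensor \<Rightarrow> bool" where
  "is_mp_inverse M N X Y \<longleftrightarrow>
     Y \<in> tensor_space (drop M (shape X) @ take M (shape X)) \<and>
     X \<star>\<^bsub>N\<^esub> Y \<star>\<^bsub>M\<^esub> X = X \<and>
     Y \<star>\<^bsub>M\<^esub> X \<star>\<^bsub>N\<^esub> Y = Y \<and>
     conj_transpose M M (X \<star>\<^bsub>N\<^esub> Y) = X \<star>\<^bsub>N\<^esub> Y \<and>
     conj_transpose N N (Y \<star>\<^bsub>M\<^esub> X) = Y \<star>\<^bsub>M\<^esub> X"

definition mp_inverse :: "nat \<Rightarrow> nat \<Rightarrow> tensor \<Rightarrow> tensor" where
  "mp_inverse M N X = (THE Y. is_mp_inverse M N X Y)"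

definition identity_tensor :: "nat list \<Rightarrow> tensor" where
  "identity_tensor Js =
     mk_tensor (Js @ Js)
       (\<lambda>is. \<Prod>k<length Js. if is ! k = is ! (length Js + k) then 1 else 0)"

definition is_tensor_inverse :: "nat list \<Rightarrow> tensor \<Rightarrow> tensor \<Rightarrow> bool" where
  "is_tensor_inverse Js C D \<longleftrightarrow>
     D \<in> tensor_space (Js @ Js) \<and>
     C \<star>\<^bsub>length Js\<^esub> D = identity_tensor Js \<and>
     D \<star>\<^bsub>length Js\<^esub> C = identity_tensor Js"

definition tensor_invertible :: "nat list \<Rightarrow> tensor \<Rightarrow> bool" where
  "tensor_invertible Js C \<longleftrightarrow> (\<exists>D. is_tensor_inverse Js C D)"

definition tensor_inverse :: "nat list \<Rightarrow> tensor \<Rightarrow> tensor" where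
  "tensor_inverse Js C = (THE D. is_tensor_inverse Js C D)"

definition tensor_eigenvalue :: "nat list \<Rightarrow> tensor \<Rightarrow> complex \<Rightarrow> bool" where
  "tensor_eigenvalue Js C lam \<longleftrightarrow>
     (\<exists>Z \<in> tensor_space Js. Z \<noteq> zero_tensor Js \<and> C \<star>\<^bsub>length Js\<^esub> Z = tensor_scale lam Z)"

definition sub_proper_splitting :: "nat \<Rightarrow> nat \<Rightarrow> tensor \<Rightarrow> tensor \<Rightarrow> tensor \<Rightarrow> bool" where
  "sub_proper_splitting M N A U V \<longleftrightarrow>
     U \<in> tensor_space (shape A) \<and> V \<in> tensor_space (shape A) \<and> A = U - V \<and>
     U \<star>\<^bsub>N\<^esub> mp_inverse M N U \<star>\<^bsub>M\<^esub> A = A \<and>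
     A \<star>\<^bsub>N\<^esub> mp_inverse M N U \<star>\<^bsub>M\<^esub> U = A"

end

theory Submission
  imports Defs "HOL-Library.Function_Algebras"
begin

text \<open>
  Put \<open>P = U\<^sup>\<dagger>U\<close>, \<open>Q = U\<^sup>\<dagger>A\<close> and \<open>C = I - U\<^sup>\<dagger>V = I - P + Q\<close>. The splitting conditions give \<open>UC = A\<close>
  and \<open>CP = PC = Q\<close>. If 1 is not an eigenvalue of \<open>U\<^sup>\<dagger>V\<close>, then \<open>C\<close> is injective, hence invertible, and
  \<open>C\<^sup>-\<^sup>1\<close> commutes with \<open>P\<close>. So \<open>Y = C\<^sup>-\<^sup>1U\<^sup>\<dagger>\<close> satisfies \<open>AY = UU\<^sup>\<dagger>\<close>, \<open>YA = P\<close> and \<open>PY = Y\<close>, from which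
  the four Penrose equations are immediate. Existence of Moore--Penrose inverses comes from
  right inverses of linear maps on their range, which provide solutions \<open>G\<close> of \<open>XGX = X\<close>.
\<close>

section \<open>Matrices over finite index sets\<close>

lemma sum_fun_apply: "(\<Sum>k\<in>K. f k) x = (\<Sum>k\<in>K. f k x)"
  for f :: "'a \<Rightarrow> 'b \<Rightarrow> 'c::comm_monoid_add"
  by (induction K rule: infinite_finite_induct) simp_all

text \<open>The scaling is an explicit parameter, as the locale \<open>vector_space\<close> expects,
  so functions into an arbitrary field form a vector space under pointwise addition.\<close>

definition fun_scale :: "'k::field \<Rightarrow> ('a \<Rightarrow> 'k) \<Rightarrow> 'a \<Rightarrow> 'k" where
  "fun_scale c v = (\<lambda>x. c * v x)"

lemma fun_scale_apply [simp]: "fun_scale c v x = c * v x"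
  by (simp add: fun_scale_def)

definition unit_fun :: "'a \<Rightarrow> 'a \<Rightarrow> 'k::field" where
  "unit_fun k = (\<lambda>x. if x = k then 1 else 0)"

lemma unit_fun_apply: "unit_fun k x = (if x = k then 1 else 0)"
  by (simp add: unit_fun_def)

lemma vector_space_fun_scale: "vector_space fun_scale"
  by unfold_locales (auto simp: fun_eq_iff algebra_simps)

text \<open>Cutting off to 0 outside \<open>I\<close> confines all images to functions supported on
  \<open>I\<close>; a finite matrix thus becomes a linear map on the whole function space.\<close>

definition mat_apply :: "'a set \<Rightarrow> 'b set \<Rightarrow> ('a \<Rightarrow> 'b \<Rightarrow> 'k::field) \<Rightarrow> ('b \<Rightarrow> 'k) \<Rightarrow> 'a \<Rightarrow> 'k" where
  "mat_apply I J c v = (\<lambda>i. if i \<in> I then \<Sum>j\<in>J. c i j * v j else 0)"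

lemma linear_mat_apply: "Vector_Spaces.linear fun_scale fun_scale (mat_apply I J c)"
  unfolding Vector_Spaces.linear_iff mat_apply_def
  by (auto simp: vector_space_fun_scale fun_eq_iff algebra_simps sum.distrib sum_distrib_left)

lemma mat_apply_unit_fun:
  "finite J \<Longrightarrow> j \<in> J \<Longrightarrow> i \<in> I \<Longrightarrow> mat_apply I J c (unit_fun j) i = c i j"
  by (simp add: mat_apply_def unit_fun_def if_distrib [of "(*) _"] cong: if_cong)

lemma unit_fun_expansion:
  assumes "finite I" and "\<And>i. i \<notin> I \<Longrightarrow> v i = 0"
  shows "v = (\<Sum>i\<in>I. fun_scale (v i) (unit_fun i))"
  using assms by (auto simp: fun_eq_iff sum_fun_apply unit_fun_def if_distrib [of "(*) _"] cong: if_cong)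

text \<open>A linear map \<open>f\<close> has a linear right inverse \<open>g\<close> on its range,
  so \<open>f (g (f v)) = f v\<close>. Reading this off at unit functions gives the matrix
  identity.\<close>

lemma ex_generalized_inverse:
  fixes c :: "'a \<Rightarrow> 'b \<Rightarrow> 'k::field"
  assumes I: "finite I" and J: "finite J"
  obtains g where "\<And>i j. i \<in> I \<Longrightarrow> j \<in> J \<Longrightarrow> (\<Sum>l\<in>J. c i l * (\<Sum>k\<in>I. g l k * c k j)) = c i j"
proof -
  interpret V: vector_space_pair "fun_scale :: 'k \<Rightarrow> ('b \<Rightarrow> 'k) \<Rightarrow> _" "fun_scale :: 'k \<Rightarrow> ('a \<Rightarrow> 'k) \<Rightarrow> _"
    by (intro vector_space_pair.intro vector_space_fun_scale)
  define f where "f = mat_apply I J c"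
  obtain g where g: "Vector_Spaces.linear fun_scale fun_scale g" "\<And>v. f (g (f v)) = f v"
    using V.linear_exists_right_inverse_on [OF linear_mat_apply, of UNIV I J c]
    unfolding f_def by auto
  interpret g: Vector_Spaces.linear fun_scale fun_scale g
    by (rule g(1))
  \<comment> \<open>The witness is the matrix of \<open>g\<close>: its column \<open>k\<close> is
    the image of the unit function at \<open>k\<close>.\<close>
  have "(\<Sum>l\<in>J. c i l * (\<Sum>k\<in>I. g (unit_fun k) l * c k j)) = c i j" if i: "i \<in> I" and j: "j \<in> J" for i j
  proof -
    define v where "v = f (unit_fun j)"
    have v: "v k = c k j" if "k \<in> I" for k
      using that J j unfolding v_def f_def by (simp add: mat_apply_unit_fun)
    \<comment> \<open>Since \<open>v\<close> vanishes outside \<open>I\<close>, it is a finite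
      combination of unit functions, and linearity of \<open>g\<close> turns \<open>g v\<close> into
      a matrix-vector product.\<close>
    have "v = (\<Sum>k\<in>I. fun_scale (v k) (unit_fun k))"
      by (rule unit_fun_expansion [OF I]) (simp add: v_def f_def mat_apply_def)
    then have "g v = (\<Sum>k\<in>I. fun_scale (v k) (g (unit_fun k)))"
      by (metis (no_types, lifting) g.scale g.sum sum.cong)
    then have "g v l = (\<Sum>k\<in>I. g (unit_fun k) l * c k j)" for l
      by (simp add: sum_fun_apply v mult.commute)
    then have "f (g v) i = (\<Sum>l\<in>J. c i l * (\<Sum>k\<in>I. g (unit_fun k) l * c k j))"
      using i by (simp add: f_def mat_apply_def)
    moreover have "f (g v) i = c i j"
      using g(2) v [OF i] unfolding v_def by simp
    ultimately show ?thesis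
      by simp
  qed
  then show thesis
    by (rule that)
qed

text \<open>An injective endomorphism of a finite-dimensional space is onto. The space is the span
  of the unit functions indexed by \<open>I\<close>, and the columns of \<open>d\<close> are
  preimages of these unit functions.\<close>

lemma ex_right_inverse_of_injective:
  fixes c :: "'a \<Rightarrow> 'a \<Rightarrow> 'k::field"
  assumes I: "finite I"
    and inj: "\<And>v j. (\<forall>i\<in>I. (\<Sum>j\<in>I. c i j * v j) = 0) \<Longrightarrow> j \<in> I \<Longrightarrow> v j = 0"
  obtains d where "\<And>i k. i \<in> I \<Longrightarrow> k \<in> I \<Longrightarrow> (\<Sum>j\<in>I. c i j * d j k) = (if i = k then 1 else 0)"
proof -
  interpret V: vector_space_pair "fun_scale :: 'k \<Rightarrow> ('a \<Rightarrow> 'k) \<Rightarrow> _" "fun_scale :: 'k \<Rightarrow> ('a \<Rightarrow> 'k) \<Rightarrow> _"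
    by (intro vector_space_pair.intro vector_space_fun_scale)
  define f where "f = mat_apply I I c"
  interpret f: Vector_Spaces.linear fun_scale fun_scale f
    unfolding f_def by (rule linear_mat_apply)
  define B :: "('a \<Rightarrow> 'k) set" where "B = unit_fun ` I"
  have inj_e: "inj_on (unit_fun :: 'a \<Rightarrow> 'a \<Rightarrow> 'k) I"
    by (rule inj_onI) (metis unit_fun_def zero_neq_one)
  have finB: "finite B"
    using I by (simp add: B_def)
  have span_B: "V.vs1.span B = {v. \<forall>i. i \<notin> I \<longrightarrow> v i = 0}"
  proof
    show "V.vs1.span B \<subseteq> {v. \<forall>i. i \<notin> I \<longrightarrow> v i = 0}"
      by (rule V.vs1.span_minimal) (auto simp: B_def unit_fun_def V.vs1.subspace_def)
    show "{v. \<forall>i. i \<notin> I \<longrightarrow> v i = 0} \<subseteq> V.vs1.span B"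
    proof clarify
      fix v :: "'a \<Rightarrow> 'k" assume "\<forall>i. i \<notin> I \<longrightarrow> v i = 0"
      then have "v = (\<Sum>i\<in>I. fun_scale (v i) (unit_fun i))"
        using unit_fun_expansion [OF I] by blast
      also have "\<dots> \<in> V.vs1.span B"
        by (intro V.vs1.span_sum V.vs1.span_scale V.vs1.span_base) (simp add: B_def)
      finally show "v \<in> V.vs1.span B" .
    qed
  qed
  have "V.vs1.independent B"
  proof -
    have "u b = 0" if sum0: "(\<Sum>b\<in>B. fun_scale (u b) b) = 0" and "b \<in> B" for u b
    proof -
      obtain k where k: "k \<in> I" "b = unit_fun k"
        using \<open>b \<in> B\<close> unfolding B_def by blast
      \<comment> \<open>Evaluation at \<open>k\<close> isolates the coefficient of
        \<open>unit_fun k\<close>.\<close>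
      have "0 = (\<Sum>b\<in>B. fun_scale (u b) b) k"
        by (simp add: sum0)
      also have "\<dots> = (\<Sum>i\<in>I. u (unit_fun i) * unit_fun i k)"
        unfolding B_def by (simp add: sum_fun_apply sum.reindex [OF inj_e])
      also have "\<dots> = u b"
        using I k by (simp add: unit_fun_apply if_distrib [of "(*) _"] cong: if_cong)
      finally show "u b = 0" by simp
    qed
    then show ?thesis
      using V.vs1.dependent_finite [OF finB] by blast
  qed
  \<comment> \<open>Injectivity is claimed on the span only: \<open>f\<close> ignores the values of
    its argument outside \<open>I\<close>.\<close>
  moreover have inj_f: "inj_on f (V.vs1.span B)"
  proof -
    have "v = 0" if v: "v \<in> V.vs1.span B" and fv: "f v = 0" for v
    proof
      fix i
      have "\<forall>i\<in>I. (\<Sum>j\<in>I. c i j * v j) = 0"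
      proof
        fix i assume "i \<in> I"
        then have "(\<Sum>j\<in>I. c i j * v j) = f v i"
          by (simp add: f_def mat_apply_def)
        then show "(\<Sum>j\<in>I. c i j * v j) = 0"
          by (simp add: fv)
      qed
      then have "i \<in> I \<Longrightarrow> v i = 0"
        by (rule inj)
      then show "v i = 0 i"
        using v unfolding span_B by (cases "i \<in> I") auto
    qed
    then show ?thesis
      using f.inj_on_iff_eq_0 [OF V.vs1.subspace_span] by blast
  qed
  ultimately have indep: "V.vs1.independent (f ` B)"
    by (intro V.linear_independent_injective_image f.linear_axioms)
  have fB: "f ` B \<subseteq> V.vs1.span B"
    unfolding span_B by (auto simp: f_def mat_apply_def)
  have "inj_on f B"
    using inj_f V.vs1.span_superset by (rule inj_on_subset)
  then have card_fB: "card (f ` B) = card B"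
    by (rule card_image)
  have surj: "B \<subseteq> V.vs1.span (f ` B)"
  proof (rule ccontr)
    assume "\<not> B \<subseteq> V.vs1.span (f ` B)"
    then obtain b where b: "b \<in> B" "b \<notin> V.vs1.span (f ` B)"
      by blast
    then have "V.vs1.independent (insert b (f ` B))"
      using indep by (intro V.vs1.independent_insertI)
    moreover have "insert b (f ` B) \<subseteq> V.vs1.span B"
      using b fB V.vs1.span_base by blast
    ultimately have "card (insert b (f ` B)) \<le> card B"
      using V.vs1.independent_span_bound [OF finB] by blast
    moreover have "b \<notin> f ` B"
      using b(2) V.vs1.span_base by blast
    ultimately show False
      using finB card_fB by simp
  qed
  have "\<exists>v. \<forall>i\<in>I. (\<Sum>j\<in>I. c i j * v j) = (if i = k then 1 else 0)" if "k \<in> I" for k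
  proof -
    have "unit_fun k \<in> V.vs1.span (f ` B)"
      using surj that unfolding B_def by blast
    then obtain v where "f v = unit_fun k"
      unfolding f.span_image by (metis imageE)
    moreover have "(\<Sum>j\<in>I. c i j * v j) = f v i" if "i \<in> I" for i
      using that by (simp add: f_def mat_apply_def)
    ultimately show ?thesis
      by (intro exI [of _ v]) (simp add: unit_fun_apply)
  qed
  then obtain d where "\<forall>k\<in>I. \<forall>i\<in>I. (\<Sum>j\<in>I. c i j * d k j) = (if i = k then 1 else 0)"
    by metis
  then show thesis
    by (intro that [of "\<lambda>j k. d k j"]) blast
qed

section \<open>Tensor algebra\<close>

lemma multi_indices_append_iff:
  assumes "length is = length Is"
  shows "is @ js \<in> multi_indices (Is @ Js) \<longleftrightarrow> is \<in> multi_indices Is \<and> js \<in> multi_indices Js"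
proof
  assume "is @ js \<in> multi_indices (Is @ Js)"
  then have len: "length js = length Js"
    and less: "\<And>k. k < length Is + length Js \<Longrightarrow> (is @ js) ! k < (Is @ Js) ! k"
    using assms by (auto simp: multi_indices_def)
  have "is ! k < Is ! k" if "k < length Is" for k
    using less [of k] that assms by (simp add: nth_append)
  moreover have "js ! k < Js ! k" if "k < length Js" for k
    using less [of "length Is + k"] that assms by (simp add: nth_append)
  ultimately show "is \<in> multi_indices Is \<and> js \<in> multi_indices Js"
    using assms len by (simp add: multi_indices_def)
next
  assume "is \<in> multi_indices Is \<and> js \<in> multi_indices Js"
  then show "is @ js \<in> multi_indices (Is @ Js)"
    by (auto simp: multi_indices_def nth_append)
qed

lemma length_multi_indices: "is \<in> multi_indices Is \<Longrightarrow> length is = length Is"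
  by (simp add: multi_indices_def)

lemma append_in_multi_indices:
  "is \<in> multi_indices Is \<Longrightarrow> js \<in> multi_indices Js \<Longrightarrow> is @ js \<in> multi_indices (Is @ Js)"
  by (simp add: multi_indices_append_iff length_multi_indices)

lemma multi_indices_appendE:
  assumes "ks \<in> multi_indices (Is @ Js)"
  obtains "is" js where "ks = is @ js" "is \<in> multi_indices Is" "js \<in> multi_indices Js"
proof -
  have "length ks = length Is + length Js"
    using length_multi_indices [OF assms] by simp
  then have "length (take (length Is) ks) = length Is"
    by simp
  then show thesis
    using that [of "take (length Is) ks" "drop (length Is) ks"] assms multi_indices_append_iff
    by (metis append_take_drop_id)
qed

lemma multi_indices_Nil [simp]: "multi_indices [] = {[]}"
  by (auto simp: multi_indices_def)

text \<open>The largest dimension bounds every component, and there are only finitely many lists of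
  fixed length over a finite set.\<close>

lemma finite_multi_indices [simp]: "finite (multi_indices ds)"
proof -
  have "multi_indices ds \<subseteq> {is. set is \<subseteq> {..Max (set ds)} \<and> length is = length ds}"
    by (fastforce simp: multi_indices_def in_set_conv_nth intro: order_trans [OF less_imp_le Max_ge])
  then show ?thesis
    by (rule finite_subset) (simp add: finite_lists_length_eq)
qed

text \<open>Shapes are kept split into a row part and a column part, so that tensors compare like
  matrices; \<open>Js = []\<close> covers column vectors.\<close>

lemma tensor_space_eqI:
  assumes "A \<in> tensor_space (Is @ Js)" "B \<in> tensor_space (Is @ Js)"
    and "\<And>is js. is \<in> multi_indices Is \<Longrightarrow> js \<in> multi_indices Js \<Longrightarrow> entry A (is @ js) = entry B (is @ js)"
  shows "A = B"
  using assms by (intro tensor_eqI) (auto simp: tensor_space_def elim!: multi_indices_appendE)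

lemma mk_tensor_in_space [simp]: "mk_tensor ds f \<in> tensor_space ds"
  by (simp add: tensor_space_def)

section \<open>The Einstein product as a matrix product\<close>

lemma einstein_closed:
  assumes "A \<in> tensor_space (Is @ Js)" "B \<in> tensor_space (Js @ Ks)"
  shows "A \<star>\<^bsub>length Js\<^esub> B \<in> tensor_space (Is @ Ks)"
  using assms by (simp add: tensor_space_def einstein_def Let_def)

text \<open>The \<open>take\<close> and \<open>drop\<close> of the definition disappear once a
  multi-index is given as row part and column part. From here on, products are matrix products
  indexed by multi-indices.\<close>

lemma entry_einstein:
  assumes "A \<in> tensor_space (Is @ Js)" "B \<in> tensor_space (Js @ Ks)"
    and "is \<in> multi_indices Is" "ks \<in> multi_indices Ks"
  shows "entry (A \<star>\<^bsub>length Js\<^esub> B) (is @ ks) = (\<Sum>js\<in>multi_indices Js. entry A (is @ js) * entry B (js @ ks))"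
  using assms
  by (simp add: tensor_space_def einstein_def Let_def entry_mk_tensor append_in_multi_indices length_multi_indices)

lemma einstein_assoc:
  assumes A: "A \<in> tensor_space (Is @ Js)" and B: "B \<in> tensor_space (Js @ Ks)" and C: "C \<in> tensor_space (Ks @ Ls)"
  shows "A \<star>\<^bsub>length Js\<^esub> B \<star>\<^bsub>length Ks\<^esub> C = A \<star>\<^bsub>length Js\<^esub> (B \<star>\<^bsub>length Ks\<^esub> C)"
proof (rule tensor_space_eqI)
  have AB: "A \<star>\<^bsub>length Js\<^esub> B \<in> tensor_space (Is @ Ks)" and BC: "B \<star>\<^bsub>length Ks\<^esub> C \<in> tensor_space (Js @ Ls)"
    using assms by (auto intro: einstein_closed)
  show "A \<star>\<^bsub>length Js\<^esub> B \<star>\<^bsub>length Ks\<^esub> C \<in> tensor_space (Is @ Ls)"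
    using AB C by (rule einstein_closed)
  show "A \<star>\<^bsub>length Js\<^esub> (B \<star>\<^bsub>length Ks\<^esub> C) \<in> tensor_space (Is @ Ls)"
    using A BC by (rule einstein_closed)
  fix "is" ls assume il: "is \<in> multi_indices Is" "ls \<in> multi_indices Ls"
  have "entry (A \<star>\<^bsub>length Js\<^esub> B \<star>\<^bsub>length Ks\<^esub> C) (is @ ls) =
      (\<Sum>ks\<in>multi_indices Ks. \<Sum>js\<in>multi_indices Js. entry A (is @ js) * (entry B (js @ ks) * entry C (ks @ ls)))"
    using il by (simp add: entry_einstein [OF AB C] entry_einstein [OF A B] sum_distrib_right mult.assoc)
  also have "\<dots> = (\<Sum>js\<in>multi_indices Js. \<Sum>ks\<in>multi_indices Ks. entry A (is @ js) * (entry B (js @ ks) * entry C (ks @ ls)))"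
    by (rule sum.swap)
  also have "\<dots> = entry (A \<star>\<^bsub>length Js\<^esub> (B \<star>\<^bsub>length Ks\<^esub> C)) (is @ ls)"
    using il by (simp add: entry_einstein [OF A BC] entry_einstein [OF B C] sum_distrib_left)
  finally show "entry (A \<star>\<^bsub>length Js\<^esub> B \<star>\<^bsub>length Ks\<^esub> C) (is @ ls) = entry (A \<star>\<^bsub>length Js\<^esub> (B \<star>\<^bsub>length Ks\<^esub> C)) (is @ ls)" .
qed

section \<open>Differences, sums and the zero tensor\<close>

lemma entry_minus: "A \<in> tensor_space ds \<Longrightarrow> B \<in> tensor_space ds \<Longrightarrow> entry (A - B) is = entry A is - entry B is"
  by (auto simp: minus_tensor_def entry_mk_tensor tensor_space_def entry_outside)

lemma entry_plus: "A \<in> tensor_space ds \<Longrightarrow> B \<in> tensor_space ds \<Longrightarrow> entry (A + B) is = entry A is + entry B is"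
  by (auto simp: plus_tensor_def entry_mk_tensor tensor_space_def entry_outside)

lemma minus_closed: "A \<in> tensor_space ds \<Longrightarrow> A - B \<in> tensor_space ds"
  by (simp add: minus_tensor_def tensor_space_def)

lemma entry_zero [simp]: "entry (zero_tensor ds) is = 0"
  by (simp add: zero_tensor_def entry_mk_tensor)

lemma zero_closed [simp]: "zero_tensor ds \<in> tensor_space ds"
  by (simp add: zero_tensor_def)

lemma minus_minus_cancel:
  assumes "A \<in> tensor_space ds" "B \<in> tensor_space ds"
  shows "A - (A - B) = B"
  using assms minus_closed [OF assms(1)]
  by (intro tensor_eqI) (auto simp: entry_minus [where ds = ds], auto simp: tensor_space_def minus_tensor_def)

lemma minus_plus_cancel:
  assumes "A \<in> tensor_space ds" "B \<in> tensor_space ds"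
  shows "A - B + B = A"
  using assms minus_closed [OF assms(1)]
  by (intro tensor_eqI) (auto simp: entry_minus [where ds = ds] entry_plus [where ds = ds], auto simp: tensor_space_def minus_tensor_def plus_tensor_def)

lemma minus_eq_zero_iff:
  assumes "A \<in> tensor_space ds" "B \<in> tensor_space ds"
  shows "A - B = zero_tensor ds \<longleftrightarrow> A = B"
proof
  assume *: "A - B = zero_tensor ds"
  have "entry A is = entry B is" for "is"
    using entry_minus [OF assms, of "is"] * by simp
  then show "A = B"
    using assms by (intro tensor_eqI) (auto simp: tensor_space_def)
next
  assume "A = B"
  then show "A - B = zero_tensor ds"
    by (intro tensor_eqI) (use assms in \<open>auto simp: entry_minus [where ds = ds], auto simp: tensor_space_def minus_tensor_def zero_tensor_def\<close>)
qed

lemma einstein_minus_right: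
  assumes "A \<in> tensor_space (Is @ Js)" "B \<in> tensor_space (Js @ Ks)" "C \<in> tensor_space (Js @ Ks)"
  shows "A \<star>\<^bsub>length Js\<^esub> (B - C) = A \<star>\<^bsub>length Js\<^esub> B - A \<star>\<^bsub>length Js\<^esub> C"
proof -
  have BC: "B - C \<in> tensor_space (Js @ Ks)"
    using assms by (auto intro: minus_closed)
  note AB = einstein_closed [OF assms(1,2)] and AC = einstein_closed [OF assms(1,3)]
  show ?thesis
    by (rule tensor_space_eqI [OF einstein_closed [OF assms(1) BC] minus_closed [OF AB]])
      (simp add: entry_minus [OF AB AC] entry_minus [OF assms(2,3)] entry_einstein [OF assms(1) BC]
        entry_einstein [OF assms(1,2)] entry_einstein [OF assms(1,3)] right_diff_distrib sum_subtractf)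
qed

lemma einstein_minus_left:
  assumes "A \<in> tensor_space (Is @ Js)" "B \<in> tensor_space (Is @ Js)" "C \<in> tensor_space (Js @ Ks)"
  shows "(A - B) \<star>\<^bsub>length Js\<^esub> C = A \<star>\<^bsub>length Js\<^esub> C - B \<star>\<^bsub>length Js\<^esub> C"
proof -
  have AB: "A - B \<in> tensor_space (Is @ Js)"
    using assms by (auto intro: minus_closed)
  note AC = einstein_closed [OF assms(1,3)] and BC = einstein_closed [OF assms(2,3)]
  show ?thesis
    by (rule tensor_space_eqI [OF einstein_closed [OF AB assms(3)] minus_closed [OF AC]])
      (simp add: entry_minus [OF AC BC] entry_minus [OF assms(1,2)] entry_einstein [OF AB assms(3)]
        entry_einstein [OF assms(1,3)] entry_einstein [OF assms(2,3)] left_diff_distrib sum_subtractf)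
qed

section \<open>The identity tensor\<close>

lemma identity_closed [simp]: "identity_tensor Js \<in> tensor_space (Js @ Js)"
  by (simp add: identity_tensor_def)

text \<open>A product of Kronecker deltas is 1 when the multi-indices agree in every position, and
  any disagreement contributes a factor 0.\<close>

lemma entry_identity:
  assumes "is \<in> multi_indices Js" "js \<in> multi_indices Js"
  shows "entry (identity_tensor Js) (is @ js) = (if is = js then 1 else 0)"
proof -
  have "entry (identity_tensor Js) (is @ js) = (\<Prod>k<length Js. if is ! k = js ! k then 1 else 0)"
    using assms by (auto simp: identity_tensor_def entry_mk_tensor append_in_multi_indices nth_append
      length_multi_indices intro!: prod.cong)
  also have "\<dots> = (if is = js then 1 else 0)"
    using assms by (auto simp: prod_zero_iff list_eq_iff_nth_eq length_multi_indices)
  finally show ?thesis .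
qed

lemma einstein_identity_left:
  assumes "A \<in> tensor_space (Is @ Ks)"
  shows "identity_tensor Is \<star>\<^bsub>length Is\<^esub> A = A"
  by (rule tensor_space_eqI [OF einstein_closed [OF identity_closed assms] assms])
    (simp add: entry_einstein [OF identity_closed assms] entry_identity if_distrib [of "\<lambda>x. x * _"] cong: if_cong)

lemma einstein_identity_right:
  assumes "A \<in> tensor_space (Is @ Js)"
  shows "A \<star>\<^bsub>length Js\<^esub> identity_tensor Js = A"
  by (rule tensor_space_eqI [OF einstein_closed [OF assms identity_closed] assms])
    (simp add: entry_einstein [OF assms identity_closed] entry_identity if_distrib [of "(*) _"] cong: if_cong)

section \<open>The conjugate transpose\<close>

lemma conj_transpose_closed:
  assumes "A \<in> tensor_space (Is @ Js)"
  shows "conj_transpose (length Is) (length Js) A \<in> tensor_space (Js @ Is)"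
  using assms by (simp add: tensor_space_def conj_transpose_def)

lemma entry_conj_transpose:
  assumes "A \<in> tensor_space (Is @ Js)" "is \<in> multi_indices Is" "js \<in> multi_indices Js"
  shows "entry (conj_transpose (length Is) (length Js) A) (js @ is) = cnj (entry A (is @ js))"
  using assms
  by (simp add: tensor_space_def conj_transpose_def entry_mk_tensor append_in_multi_indices length_multi_indices)

lemma conj_transpose_conj_transpose:
  assumes "A \<in> tensor_space (Is @ Js)"
  shows "conj_transpose (length Js) (length Is) (conj_transpose (length Is) (length Js) A) = A"
  by (rule tensor_space_eqI [OF conj_transpose_closed [OF conj_transpose_closed [OF assms]] assms])
    (simp add: entry_conj_transpose [OF conj_transpose_closed [OF assms]] entry_conj_transpose [OF assms])

lemma conj_transpose_einstein:
  assumes A: "A \<in> tensor_space (Is @ Js)" and B: "B \<in> tensor_space (Js @ Ks)"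
  shows "conj_transpose (length Is) (length Ks) (A \<star>\<^bsub>length Js\<^esub> B) =
    conj_transpose (length Js) (length Ks) B \<star>\<^bsub>length Js\<^esub> conj_transpose (length Is) (length Js) A"
proof -
  note AB = einstein_closed [OF A B] and A' = conj_transpose_closed [OF A] and B' = conj_transpose_closed [OF B]
  show ?thesis
    by (rule tensor_space_eqI [OF conj_transpose_closed [OF AB] einstein_closed [OF B' A']])
      (simp add: entry_conj_transpose [OF AB] entry_einstein [OF A B] entry_einstein [OF B' A']
        entry_conj_transpose [OF A] entry_conj_transpose [OF B] mult.commute)
qed

text \<open>The diagonal entry of \<open>A\<^sup>HA\<close> at \<open>js\<close> is the sum of the
  squared moduli in column \<open>js\<close> of \<open>A\<close>, so it vanishes only if the whole
  column does.\<close>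

lemma conj_transpose_einstein_self_eq_zero:
  assumes A: "A \<in> tensor_space (Is @ Js)"
    and zero: "conj_transpose (length Is) (length Js) A \<star>\<^bsub>length Is\<^esub> A = zero_tensor (Js @ Js)"
  shows "A = zero_tensor (Is @ Js)"
proof (rule tensor_space_eqI [OF A zero_closed])
  fix "is" js assume ij: "is \<in> multi_indices Is" "js \<in> multi_indices Js"
  have "complex_of_real (\<Sum>is\<in>multi_indices Is. (cmod (entry A (is @ js)))\<^sup>2) =
      (\<Sum>is\<in>multi_indices Is. cnj (entry A (is @ js)) * entry A (is @ js))"
    by (simp add: complex_norm_square mult.commute del: of_real_power)
  also have "\<dots> = entry (conj_transpose (length Is) (length Js) A \<star>\<^bsub>length Is\<^esub> A) (js @ js)"
    using ij by (simp add: entry_einstein [OF conj_transpose_closed [OF A] A] entry_conj_transpose [OF A])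
  also have "\<dots> = 0"
    by (simp add: zero)
  finally have "(\<Sum>is\<in>multi_indices Is. (cmod (entry A (is @ js)))\<^sup>2) = 0"
    by (simp only: of_real_eq_0_iff)
  then have "(cmod (entry A (is @ js)))\<^sup>2 = 0"
    using ij by (subst (asm) sum_nonneg_eq_0_iff) auto
  then show "entry A (is @ js) = entry (zero_tensor (Is @ Js)) (is @ js)"
    by simp
qed

section \<open>Generalized inverses\<close>

lemma ex_tensor_generalized_inverse:
  assumes X: "X \<in> tensor_space (Is @ Js)"
  obtains G where "G \<in> tensor_space (Js @ Is)" and "X \<star>\<^bsub>length Js\<^esub> (G \<star>\<^bsub>length Is\<^esub> X) = X"
proof -
  obtain g where g: "\<And>i j. i \<in> multi_indices Is \<Longrightarrow> j \<in> multi_indices Js \<Longrightarrow>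
      (\<Sum>l\<in>multi_indices Js. entry X (i @ l) * (\<Sum>k\<in>multi_indices Is. g l k * entry X (k @ j))) = entry X (i @ j)"
    using ex_generalized_inverse [of "multi_indices Is" "multi_indices Js" "\<lambda>i j. entry X (i @ j)"] by auto
  define G where "G = mk_tensor (Js @ Is) (\<lambda>ks. g (take (length Js) ks) (drop (length Js) ks))"
  have G: "G \<in> tensor_space (Js @ Is)"
    by (simp add: G_def)
  have entry_G: "entry G (l @ k) = g l k" if "l \<in> multi_indices Js" "k \<in> multi_indices Is" for l k
    using that by (simp add: G_def entry_mk_tensor append_in_multi_indices length_multi_indices)
  note GX = einstein_closed [OF G X]
  have "X \<star>\<^bsub>length Js\<^esub> (G \<star>\<^bsub>length Is\<^esub> X) = X"
    by (rule tensor_space_eqI [OF einstein_closed [OF X GX] X])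
      (simp add: entry_einstein [OF X GX] entry_einstein [OF G X] entry_G g)
  with G show thesis
    by (rule that)
qed

text \<open>Injectivity gives a right inverse \<open>D\<close> by dimension. Then
  \<open>CDC = C\<close>, so \<open>C\<close> annihilates every column of \<open>DC - I\<close>, and
  injectivity forces \<open>DC = I\<close>.\<close>

lemma tensor_invertible_of_injective:
  assumes C: "C \<in> tensor_space (Js @ Js)"
    and inj: "\<And>Z. Z \<in> tensor_space Js \<Longrightarrow> C \<star>\<^bsub>length Js\<^esub> Z = zero_tensor Js \<Longrightarrow> Z = zero_tensor Js"
  shows "tensor_invertible Js C"
proof -
  let ?I = "multi_indices Js"
  have vec_inj: "v j = 0" if v: "\<forall>i\<in>?I. (\<Sum>j\<in>?I. entry C (i @ j) * v j) = 0" and j: "j \<in> ?I" for v j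
  proof -
    \<comment> \<open>Writing the shape as \<open>Js @ []\<close> treats a vector as a matrix
      without column indices, so the laws of the product apply to it.\<close>
    have Z: "mk_tensor Js v \<in> tensor_space (Js @ [])"
      by simp
    have "entry (C \<star>\<^bsub>length Js\<^esub> mk_tensor Js v) (i @ []) = 0" if "i \<in> ?I" for i
      using v that entry_einstein [OF C Z that, of "[]"] by (simp add: entry_mk_tensor)
    then have "C \<star>\<^bsub>length Js\<^esub> mk_tensor Js v = zero_tensor (Js @ [])"
      by (intro tensor_space_eqI [OF einstein_closed [OF C Z] zero_closed]) simp
    then have "mk_tensor Js v = zero_tensor Js"
      using inj [OF mk_tensor_in_space] by simp
    then show "v j = 0"
      using j entry_mk_tensor [of Js v j] by simp
  qed
  obtain d where d: "\<And>i k. i \<in> ?I \<Longrightarrow> k \<in> ?I \<Longrightarrow>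
      (\<Sum>j\<in>?I. entry C (i @ j) * d j k) = (if i = k then 1 else 0)"
    by (rule ex_right_inverse_of_injective [OF finite_multi_indices, of Js "\<lambda>i j. entry C (i @ j)"])
      (erule (1) vec_inj, rule that)
  define D where "D = mk_tensor (Js @ Js) (\<lambda>ks. d (take (length Js) ks) (drop (length Js) ks))"
  have D: "D \<in> tensor_space (Js @ Js)"
    by (simp add: D_def)
  have entry_D: "entry D (l @ k) = d l k" if "l \<in> ?I" "k \<in> ?I" for l k
    using that by (simp add: D_def entry_mk_tensor append_in_multi_indices length_multi_indices)
  have CD: "C \<star>\<^bsub>length Js\<^esub> D = identity_tensor Js"
    by (rule tensor_space_eqI [OF einstein_closed [OF C D] identity_closed])
      (simp add: entry_einstein [OF C D] entry_identity entry_D d)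
  note DC = einstein_closed [OF D C]
  have CDC: "C \<star>\<^bsub>length Js\<^esub> (D \<star>\<^bsub>length Js\<^esub> C) = C"
    by (simp add: einstein_assoc [OF C D C, symmetric] CD einstein_identity_left [OF C])
  have "D \<star>\<^bsub>length Js\<^esub> C = identity_tensor Js"
  proof (rule tensor_space_eqI [OF DC identity_closed])
    fix j k assume jk: "j \<in> ?I" "k \<in> ?I"
    \<comment> \<open>This is column \<open>k\<close> of \<open>DC - I\<close>.\<close>
    define v where "v l = entry (D \<star>\<^bsub>length Js\<^esub> C) (l @ k) - entry (identity_tensor Js) (l @ k)" for l
    have "(\<Sum>l\<in>?I. entry C (i @ l) * v l) = 0" if "i \<in> ?I" for i
      using entry_einstein [OF C DC that jk(2)] entry_einstein [OF C identity_closed that jk(2)]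
      by (simp add: v_def right_diff_distrib sum_subtractf CDC einstein_identity_right [OF C])
    then have "v j = 0"
      using jk(1) by (intro vec_inj) auto
    then show "entry (D \<star>\<^bsub>length Js\<^esub> C) (j @ k) = entry (identity_tensor Js) (j @ k)"
      by (simp add: v_def)
  qed
  with CD D show ?thesis
    unfolding tensor_invertible_def is_tensor_inverse_def by blast
qed

lemma is_tensor_inverse_unique:
  assumes C: "C \<in> tensor_space (Js @ Js)" and D: "is_tensor_inverse Js C D" and E: "is_tensor_inverse Js C E"
  shows "D = E"
proof -
  have D': "D \<in> tensor_space (Js @ Js)" and E': "E \<in> tensor_space (Js @ Js)"
    using D E by (auto simp: is_tensor_inverse_def)
  have "D = D \<star>\<^bsub>length Js\<^esub> (C \<star>\<^bsub>length Js\<^esub> E)"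
    using E by (simp add: is_tensor_inverse_def einstein_identity_right [OF D'])
  also have "\<dots> = E"
    using D by (simp add: is_tensor_inverse_def einstein_identity_left [OF E'] einstein_assoc [OF D' C E', symmetric])
  finally show ?thesis .
qed

lemma is_tensor_inverse_tensor_inverse:
  assumes "C \<in> tensor_space (Js @ Js)" "tensor_invertible Js C"
  shows "is_tensor_inverse Js C (tensor_inverse Js C)"
  using assms is_tensor_inverse_unique theI' [of "is_tensor_inverse Js C"]
  unfolding tensor_invertible_def tensor_inverse_def by blast

text \<open>For \<open>E = X(B - C)\<close> the hypothesis reads \<open>X\<^sup>HE = 0\<close>.
  Multiplying by \<open>(B - C)\<^sup>H\<close> from the left gives \<open>E\<^sup>HE = 0\<close>,
  hence \<open>E = 0\<close>.\<close>

lemma conj_transpose_einstein_cancel: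
  assumes X: "X \<in> tensor_space (Is @ Js)" and B: "B \<in> tensor_space (Js @ Ks)" and C: "C \<in> tensor_space (Js @ Ks)"
    and eq: "conj_transpose (length Is) (length Js) X \<star>\<^bsub>length Is\<^esub> (X \<star>\<^bsub>length Js\<^esub> B) =
      conj_transpose (length Is) (length Js) X \<star>\<^bsub>length Is\<^esub> (X \<star>\<^bsub>length Js\<^esub> C)"
  shows "X \<star>\<^bsub>length Js\<^esub> B = X \<star>\<^bsub>length Js\<^esub> C"
proof -
  define X' where "X' = conj_transpose (length Is) (length Js) X"
  have X': "X' \<in> tensor_space (Js @ Is)"
    unfolding X'_def by (rule conj_transpose_closed [OF X])
  note XB = einstein_closed [OF X B] and XC = einstein_closed [OF X C] and BC = minus_closed [OF B, of C]
  note BC' = conj_transpose_closed [OF BC] and XBC = einstein_closed [OF X BC]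
  define E where "E = X \<star>\<^bsub>length Js\<^esub> (B - C)"
  have E: "E \<in> tensor_space (Is @ Ks)"
    unfolding E_def by (rule XBC)
  have "X' \<star>\<^bsub>length Is\<^esub> E = zero_tensor (Js @ Ks)"
    using eq unfolding E_def X'_def [symmetric]
    by (simp add: einstein_minus_right [OF X B C] einstein_minus_right [OF X' XB XC]
      minus_eq_zero_iff [OF einstein_closed [OF X' XC] einstein_closed [OF X' XC]])
  moreover have "conj_transpose (length Js) (length Ks) (B - C) \<star>\<^bsub>length Js\<^esub> zero_tensor (Js @ Ks) = zero_tensor (Ks @ Ks)"
    by (rule tensor_space_eqI [OF einstein_closed [OF BC' zero_closed] zero_closed])
      (simp add: entry_einstein [OF BC' zero_closed])
  ultimately have "conj_transpose (length Is) (length Ks) E \<star>\<^bsub>length Is\<^esub> E = zero_tensor (Ks @ Ks)"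
    using einstein_assoc [OF BC' X' E] unfolding X'_def E_def by (simp add: conj_transpose_einstein [OF X BC])
  then have "E = zero_tensor (Is @ Ks)"
    by (rule conj_transpose_einstein_self_eq_zero [OF E])
  then show ?thesis
    unfolding E_def by (simp add: einstein_minus_right [OF X B C] minus_eq_zero_iff [OF XB XC])
qed

text \<open>
  If \<open>G\<close> is a generalized inverse of \<open>X\<^sup>HX\<close>, cancelling \<open>X\<^sup>H\<close> shows that \<open>L = GX\<^sup>H\<close> is one of \<open>X\<close>.
  Then \<open>E = XL\<close> satisfies \<open>E E\<^sup>H = E\<^sup>H\<close>, so it is Hermitian.
\<close>

lemma ex_hermitian_generalized_inverse:
  assumes X: "X \<in> tensor_space (Is @ Js)"
  obtains L where "L \<in> tensor_space (Js @ Is)"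
    and "X \<star>\<^bsub>length Js\<^esub> (L \<star>\<^bsub>length Is\<^esub> X) = X"
    and "conj_transpose (length Is) (length Is) (X \<star>\<^bsub>length Js\<^esub> L) = X \<star>\<^bsub>length Js\<^esub> L"
proof -
  define X' where "X' = conj_transpose (length Is) (length Js) X"
  have X': "X' \<in> tensor_space (Js @ Is)"
    unfolding X'_def by (rule conj_transpose_closed [OF X])
  have X'': "conj_transpose (length Js) (length Is) X' = X"
    unfolding X'_def by (rule conj_transpose_conj_transpose [OF X])
  note X'X = einstein_closed [OF X' X]
  obtain G where G: "G \<in> tensor_space (Js @ Js)"
    and X'XG: "X' \<star>\<^bsub>length Is\<^esub> X \<star>\<^bsub>length Js\<^esub> (G \<star>\<^bsub>length Js\<^esub> (X' \<star>\<^bsub>length Is\<^esub> X)) = X' \<star>\<^bsub>length Is\<^esub> X"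
    by (rule ex_tensor_generalized_inverse [OF X'X])
  define L where "L = G \<star>\<^bsub>length Js\<^esub> X'"
  have L: "L \<in> tensor_space (Js @ Is)"
    unfolding L_def by (rule einstein_closed [OF G X'])
  note LX = einstein_closed [OF L X] and XL = einstein_closed [OF X L]
  have LX_eq: "L \<star>\<^bsub>length Is\<^esub> X = G \<star>\<^bsub>length Js\<^esub> (X' \<star>\<^bsub>length Is\<^esub> X)"
    unfolding L_def by (rule einstein_assoc [OF G X' X])
  \<comment> \<open>The right-hand side is written with \<open>X\<close> times the identity so that
    both sides have the form required for cancelling \<open>X\<^sup>H\<close>.\<close>
  have "X' \<star>\<^bsub>length Is\<^esub> (X \<star>\<^bsub>length Js\<^esub> (L \<star>\<^bsub>length Is\<^esub> X)) = X' \<star>\<^bsub>length Is\<^esub> (X \<star>\<^bsub>length Js\<^esub> identity_tensor Js)"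
    using X'XG einstein_assoc [OF X' X LX] by (simp add: einstein_identity_right [OF X] LX_eq)
  then have "X \<star>\<^bsub>length Js\<^esub> (L \<star>\<^bsub>length Is\<^esub> X) = X \<star>\<^bsub>length Js\<^esub> identity_tensor Js"
    unfolding X'_def by (rule conj_transpose_einstein_cancel [OF X LX identity_closed])
  then have XLX: "X \<star>\<^bsub>length Js\<^esub> (L \<star>\<^bsub>length Is\<^esub> X) = X"
    by (simp add: einstein_identity_right [OF X])
  define E where "E = X \<star>\<^bsub>length Js\<^esub> L"
  have E: "E \<in> tensor_space (Is @ Is)"
    unfolding E_def by (rule XL)
  define E' where "E' = conj_transpose (length Is) (length Is) E"
  have E': "E' \<in> tensor_space (Is @ Is)"
    unfolding E'_def by (rule conj_transpose_closed [OF E])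
  define G' where "G' = conj_transpose (length Js) (length Js) G"
  have G': "G' \<in> tensor_space (Js @ Js)"
    unfolding G'_def by (rule conj_transpose_closed [OF G])
  note G'X' = einstein_closed [OF G' X']
  \<comment> \<open>Transposing \<open>L = GX\<^sup>H\<close> shows that
    \<open>E\<^sup>H = XG\<^sup>HX\<^sup>H\<close> begins with the factor \<open>X\<close>. Since
    \<open>EX = X\<close>, multiplication by \<open>E\<close> from the left leaves
    \<open>E\<^sup>H\<close> unchanged.\<close>
  have "E' = conj_transpose (length Js) (length Is) L \<star>\<^bsub>length Js\<^esub> X'"
    unfolding E'_def E_def X'_def by (rule conj_transpose_einstein [OF X L])
  also have "conj_transpose (length Js) (length Is) L = X \<star>\<^bsub>length Js\<^esub> G'"
    unfolding L_def G'_def by (simp add: conj_transpose_einstein [OF G X'] X'')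
  finally have E'_eq: "E' = X \<star>\<^bsub>length Js\<^esub> (G' \<star>\<^bsub>length Js\<^esub> X')"
    by (simp add: einstein_assoc [OF X G' X'])
  have "E \<star>\<^bsub>length Is\<^esub> E' = E \<star>\<^bsub>length Is\<^esub> X \<star>\<^bsub>length Js\<^esub> (G' \<star>\<^bsub>length Js\<^esub> X')"
    unfolding E'_eq by (rule einstein_assoc [OF E X G'X', symmetric])
  also have "E \<star>\<^bsub>length Is\<^esub> X = X"
    unfolding E_def by (simp add: einstein_assoc [OF X L X] XLX)
  finally have EE': "E \<star>\<^bsub>length Is\<^esub> E' = E'"
    by (simp add: E'_eq)
  have "conj_transpose (length Is) (length Is) (E \<star>\<^bsub>length Is\<^esub> E') = E \<star>\<^bsub>length Is\<^esub> E'"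
    unfolding conj_transpose_einstein [OF E E'] by (simp add: E'_def conj_transpose_conj_transpose [OF E])
  then have "E = E'"
    unfolding EE' by (simp add: E'_def conj_transpose_conj_transpose [OF E])
  then have "conj_transpose (length Is) (length Is) (X \<star>\<^bsub>length Js\<^esub> L) = X \<star>\<^bsub>length Js\<^esub> L"
    unfolding E_def E'_def by (rule sym)
  with L XLX show thesis
    by (rule that)
qed

section \<open>The Moore--Penrose inverse\<close>

lemma is_mp_inverse_iff:
  assumes "X \<in> tensor_space (Is @ Js)"
  shows "is_mp_inverse (length Is) (length Js) X Y \<longleftrightarrow>
    Y \<in> tensor_space (Js @ Is) \<and>
    X \<star>\<^bsub>length Js\<^esub> Y \<star>\<^bsub>length Is\<^esub> X = X \<and>
    Y \<star>\<^bsub>length Is\<^esub> X \<star>\<^bsub>length Js\<^esub> Y = Y \<and>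
    conj_transpose (length Is) (length Is) (X \<star>\<^bsub>length Js\<^esub> Y) = X \<star>\<^bsub>length Js\<^esub> Y \<and>
    conj_transpose (length Js) (length Js) (Y \<star>\<^bsub>length Is\<^esub> X) = Y \<star>\<^bsub>length Is\<^esub> X"
  using assms by (simp add: is_mp_inverse_def tensor_space_def)

text \<open>The Hermitian construction for \<open>X\<close> gives \<open>L\<close> with
  \<open>XL\<close> Hermitian; for \<open>X\<^sup>H\<close> it gives, after transposing,
  \<open>K\<close> with \<open>KX\<close> Hermitian. Both are generalized inverses, and
  \<open>Y = KXL\<close> has \<open>XY = XL\<close> and \<open>YX = KX\<close>, so all four
  equations follow.\<close>

lemma ex_mp_inverse:
  assumes X: "X \<in> tensor_space (Is @ Js)"
  shows "\<exists>Y. is_mp_inverse (length Is) (length Js) X Y"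
proof -
  define X' where "X' = conj_transpose (length Is) (length Js) X"
  have X': "X' \<in> tensor_space (Js @ Is)"
    unfolding X'_def by (rule conj_transpose_closed [OF X])
  have X'': "conj_transpose (length Js) (length Is) X' = X"
    unfolding X'_def by (rule conj_transpose_conj_transpose [OF X])
  obtain L where L: "L \<in> tensor_space (Js @ Is)"
    and XLX: "X \<star>\<^bsub>length Js\<^esub> (L \<star>\<^bsub>length Is\<^esub> X) = X"
    and XL_herm: "conj_transpose (length Is) (length Is) (X \<star>\<^bsub>length Js\<^esub> L) = X \<star>\<^bsub>length Js\<^esub> L"
    by (rule ex_hermitian_generalized_inverse [OF X])
  obtain K' where K': "K' \<in> tensor_space (Is @ Js)"
    and XKX': "X' \<star>\<^bsub>length Is\<^esub> (K' \<star>\<^bsub>length Js\<^esub> X') = X'"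
    and KX'_herm: "conj_transpose (length Js) (length Js) (X' \<star>\<^bsub>length Is\<^esub> K') = X' \<star>\<^bsub>length Is\<^esub> K'"
    by (rule ex_hermitian_generalized_inverse [OF X'])
  define K where "K = conj_transpose (length Is) (length Js) K'"
  have K: "K \<in> tensor_space (Js @ Is)"
    unfolding K_def by (rule conj_transpose_closed [OF K'])
  note XL = einstein_closed [OF X L]
  \<comment> \<open>The product \<open>X'K'\<close> is Hermitian and its conjugate transpose is
    \<open>KX\<close>, so the two coincide.\<close>
  have KX_eq: "K \<star>\<^bsub>length Is\<^esub> X = X' \<star>\<^bsub>length Is\<^esub> K'"
    using conj_transpose_einstein [OF X' K'] by (simp add: KX'_herm K_def X'')
  have XKX: "X \<star>\<^bsub>length Js\<^esub> (K \<star>\<^bsub>length Is\<^esub> X) = X"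
  proof -
    have "X = conj_transpose (length Js) (length Is) (X' \<star>\<^bsub>length Is\<^esub> (K' \<star>\<^bsub>length Js\<^esub> X'))"
      by (simp add: XKX' X'')
    also have "\<dots> = X \<star>\<^bsub>length Js\<^esub> K \<star>\<^bsub>length Is\<^esub> X"
      by (simp add: conj_transpose_einstein [OF X' einstein_closed [OF K' X']]
          conj_transpose_einstein [OF K' X'] X'' K_def)
    finally show ?thesis
      by (simp add: einstein_assoc [OF X K X])
  qed
  \<comment> \<open>Urquhart's formula: a \<open>{1,4}\<close>-inverse \<open>K\<close> and a \<open>{1,3}\<close>-inverse \<open>L\<close> combine to \<open>KXL\<close>.\<close>
  define Y where "Y = K \<star>\<^bsub>length Is\<^esub> (X \<star>\<^bsub>length Js\<^esub> L)"
  have Y: "Y \<in> tensor_space (Js @ Is)"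
    unfolding Y_def by (rule einstein_closed [OF K XL])
  have XY: "X \<star>\<^bsub>length Js\<^esub> Y = X \<star>\<^bsub>length Js\<^esub> L"
    using einstein_assoc [OF X K XL] einstein_assoc [OF einstein_closed [OF X K] X L]
      einstein_assoc [OF X K X] by (simp add: Y_def XKX)
  have YX: "Y \<star>\<^bsub>length Is\<^esub> X = K \<star>\<^bsub>length Is\<^esub> X"
    unfolding Y_def by (simp add: einstein_assoc [OF K XL X] einstein_assoc [OF X L X] XLX)
  have "X \<star>\<^bsub>length Js\<^esub> Y \<star>\<^bsub>length Is\<^esub> X = X"
    by (simp add: XY einstein_assoc [OF X L X] XLX)
  moreover have "Y \<star>\<^bsub>length Is\<^esub> X \<star>\<^bsub>length Js\<^esub> Y = Y"
    unfolding YX einstein_assoc [OF K X Y] XY by (simp add: Y_def)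
  ultimately show ?thesis
    using Y XL_herm KX'_herm unfolding is_mp_inverse_iff [OF X] by (auto simp: XY YX KX_eq)
qed

text \<open>The Hermitian products absorb each other: \<open>(XZ)(XY) = XY\<close> and
  \<open>(XY)(XZ) = XZ\<close>. Transposing the first swaps its factors, so \<open>XY = XZ\<close>;
  likewise \<open>YX = ZX\<close>. Hence \<open>Y = YXY = ZXY = ZXZ = Z\<close>.\<close>

lemma is_mp_inverse_unique:
  assumes X: "X \<in> tensor_space (Is @ Js)"
    and Y: "is_mp_inverse (length Is) (length Js) X Y" and Z: "is_mp_inverse (length Is) (length Js) X Z"
  shows "Y = Z"
proof -
  have Yc: "Y \<in> tensor_space (Js @ Is)" and Zc: "Z \<in> tensor_space (Js @ Is)"
    using Y Z unfolding is_mp_inverse_iff [OF X] by auto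
  note XY = einstein_closed [OF X Yc] and XZ = einstein_closed [OF X Zc]
    and YX = einstein_closed [OF Yc X] and ZX = einstein_closed [OF Zc X]
  have XZXY: "X \<star>\<^bsub>length Js\<^esub> Z \<star>\<^bsub>length Is\<^esub> (X \<star>\<^bsub>length Js\<^esub> Y) = X \<star>\<^bsub>length Js\<^esub> Y"
    using Z by (simp add: einstein_assoc [OF XZ X Yc, symmetric] is_mp_inverse_iff [OF X])
  have XYXZ: "X \<star>\<^bsub>length Js\<^esub> Y \<star>\<^bsub>length Is\<^esub> (X \<star>\<^bsub>length Js\<^esub> Z) = X \<star>\<^bsub>length Js\<^esub> Z"
    using Y by (simp add: einstein_assoc [OF XY X Zc, symmetric] is_mp_inverse_iff [OF X])
  have XY_eq: "X \<star>\<^bsub>length Js\<^esub> Y = X \<star>\<^bsub>length Js\<^esub> Z"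
    using conj_transpose_einstein [OF XZ XY] Y Z by (simp add: XZXY XYXZ is_mp_inverse_iff [OF X])
  have YXZX: "Y \<star>\<^bsub>length Is\<^esub> X \<star>\<^bsub>length Js\<^esub> (Z \<star>\<^bsub>length Is\<^esub> X) = Y \<star>\<^bsub>length Is\<^esub> X"
    using Z by (simp add: einstein_assoc [OF Yc X ZX] einstein_assoc [OF X Zc X, symmetric] is_mp_inverse_iff [OF X])
  have ZXYX: "Z \<star>\<^bsub>length Is\<^esub> X \<star>\<^bsub>length Js\<^esub> (Y \<star>\<^bsub>length Is\<^esub> X) = Z \<star>\<^bsub>length Is\<^esub> X"
    using Y by (simp add: einstein_assoc [OF Zc X YX] einstein_assoc [OF X Yc X, symmetric] is_mp_inverse_iff [OF X])
  have YX_eq: "Y \<star>\<^bsub>length Is\<^esub> X = Z \<star>\<^bsub>length Is\<^esub> X"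
    using conj_transpose_einstein [OF YX ZX] Y Z by (simp add: YXZX ZXYX is_mp_inverse_iff [OF X])
  have "Y = Z \<star>\<^bsub>length Is\<^esub> X \<star>\<^bsub>length Js\<^esub> Y"
    using Y by (simp add: YX_eq [symmetric] is_mp_inverse_iff [OF X])
  also have "\<dots> = Z \<star>\<^bsub>length Is\<^esub> X \<star>\<^bsub>length Js\<^esub> Z"
    by (simp add: einstein_assoc [OF Zc X Yc] einstein_assoc [OF Zc X Zc] XY_eq)
  also have "\<dots> = Z"
    using Z by (simp add: is_mp_inverse_iff [OF X])
  finally show ?thesis .
qed

lemma is_mp_inverse_mp_inverse:
  assumes "X \<in> tensor_space (Is @ Js)"
  shows "is_mp_inverse (length Is) (length Js) X (mp_inverse (length Is) (length Js) X)"
  using ex_mp_inverse [OF assms] is_mp_inverse_unique [OF assms]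
    theI' [of "is_mp_inverse (length Is) (length Js) X"]
  unfolding mp_inverse_def by blast

lemma mp_inverse_eqI:
  assumes "X \<in> tensor_space (Is @ Js)" "is_mp_inverse (length Is) (length Js) X Y"
  shows "mp_inverse (length Is) (length Js) X = Y"
  using assms is_mp_inverse_unique is_mp_inverse_mp_inverse by blast

section \<open>Sub-proper splittings\<close>

theorem theorem3p11:
  fixes Is Js :: "nat list" and M N :: nat and A U V :: tensor
  assumes "M = length Is" and "N = length Js" and "M \<ge> 1" and "N \<ge> 1"
    and "\<forall>d \<in> set Is \<union> set Js. d \<ge> 1"
    and "A \<in> tensor_space (Is @ Js)"
    and "sub_proper_splitting M N A U V"
  shows "A = U \<star>\<^bsub>N\<^esub> (identity_tensor Js - mp_inverse M N U \<star>\<^bsub>M\<^esub> V) \<and>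
    (\<not> tensor_eigenvalue Js (mp_inverse M N U \<star>\<^bsub>M\<^esub> V) 1 \<longrightarrow>
      (tensor_invertible Js (identity_tensor Js - mp_inverse M N U \<star>\<^bsub>M\<^esub> V) \<and>
       mp_inverse M N A =
         tensor_inverse Js (identity_tensor Js - mp_inverse M N U \<star>\<^bsub>M\<^esub> V) \<star>\<^bsub>N\<^esub> mp_inverse M N U) \<and>
      (\<forall>B \<in> tensor_space Is. (\<exists>X \<in> tensor_space Js. A \<star>\<^bsub>N\<^esub> X = B) \<longrightarrow>
        (\<forall>X \<in> tensor_space Js.
           A \<star>\<^bsub>N\<^esub> X = B \<and> mp_inverse M N U \<star>\<^bsub>M\<^esub> U \<star>\<^bsub>N\<^esub> X = X \<longrightarrow>
           X = mp_inverse M N U \<star>\<^bsub>M\<^esub> V \<star>\<^bsub>N\<^esub> X + mp_inverse M N U \<star>\<^bsub>M\<^esub> B) \<and>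
        (let X = mp_inverse M N A \<star>\<^bsub>M\<^esub> B in
           X \<in> tensor_space Js \<and> A \<star>\<^bsub>N\<^esub> X = B \<and>
           mp_inverse M N U \<star>\<^bsub>M\<^esub> U \<star>\<^bsub>N\<^esub> X = X)))"
proof -
  have M: "M = length Is" and N: "N = length Js"
    by fact+
  have A: "A \<in> tensor_space (Is @ Js)"
    by fact
  have shape_A: "shape A = Is @ Js"
    using A by (simp add: tensor_space_def)
  define Ui where "Ui = mp_inverse M N U"
  have U: "U \<in> tensor_space (Is @ Js)" and V: "V \<in> tensor_space (Is @ Js)" and A_eq: "A = U - V"
    and UUiA: "U \<star>\<^bsub>N\<^esub> Ui \<star>\<^bsub>M\<^esub> A = A" and AUiU: "A \<star>\<^bsub>N\<^esub> Ui \<star>\<^bsub>M\<^esub> U = A"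
    using assms(7) unfolding sub_proper_splitting_def Ui_def shape_A by blast+
  have "is_mp_inverse M N U Ui"
    unfolding Ui_def M N by (rule is_mp_inverse_mp_inverse [OF U])
  then have Ui: "Ui \<in> tensor_space (Js @ Is)" and UUiU: "U \<star>\<^bsub>N\<^esub> Ui \<star>\<^bsub>M\<^esub> U = U"
    and UiUUi: "Ui \<star>\<^bsub>M\<^esub> U \<star>\<^bsub>N\<^esub> Ui = Ui"
    and UUi_herm: "conj_transpose M M (U \<star>\<^bsub>N\<^esub> Ui) = U \<star>\<^bsub>N\<^esub> Ui"
    and UiU_herm: "conj_transpose N N (Ui \<star>\<^bsub>M\<^esub> U) = Ui \<star>\<^bsub>M\<^esub> U"
    unfolding M N is_mp_inverse_iff [OF U] by auto
  \<comment> \<open>Eliminating \<open>V\<close> expresses \<open>W\<close> through \<open>P\<close>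
    and \<open>Q\<close>, so all that follows is algebra with these two.\<close>
  have V_eq: "V = U - A"
    unfolding A_eq by (rule minus_minus_cancel [OF U V, symmetric])
  define P where "P = Ui \<star>\<^bsub>M\<^esub> U"
  have P: "P \<in> tensor_space (Js @ Js)"
    unfolding P_def M by (rule einstein_closed [OF Ui U])
  define Q where "Q = Ui \<star>\<^bsub>M\<^esub> A"
  have Q: "Q \<in> tensor_space (Js @ Js)"
    unfolding Q_def M by (rule einstein_closed [OF Ui A])
  define W where "W = Ui \<star>\<^bsub>M\<^esub> V"
  have W_eq: "W = P - Q"
    unfolding W_def V_eq P_def Q_def M by (rule einstein_minus_right [OF Ui U A])
  have W: "W \<in> tensor_space (Js @ Js)"
    unfolding W_eq by (rule minus_closed [OF P])
  define C where "C = identity_tensor Js - W"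
  have C: "C \<in> tensor_space (Js @ Js)"
    unfolding C_def by (rule minus_closed [OF identity_closed])
  \<comment> \<open>The first identity is a Penrose equation for \<open>U\<close>;
    \<open>UQ = A\<close> and \<open>AP = A\<close> are the two sub-proper conditions,
    reassociated.\<close>
  have UP: "U \<star>\<^bsub>N\<^esub> P = U"
    using UUiU unfolding P_def M N by (simp add: einstein_assoc [OF U Ui U])
  have UQ: "U \<star>\<^bsub>N\<^esub> Q = A"
    using UUiA unfolding Q_def M N by (simp add: einstein_assoc [OF U Ui A])
  have AP: "A \<star>\<^bsub>N\<^esub> P = A"
    using AUiU unfolding P_def M N by (simp add: einstein_assoc [OF A Ui U])
  have PUi: "P \<star>\<^bsub>N\<^esub> Ui = Ui"
    using UiUUi by (simp add: P_def)
  have PP: "P \<star>\<^bsub>N\<^esub> P = P"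
    using UP unfolding P_def M N by (simp add: einstein_assoc [OF Ui U P, unfolded P_def M])
  have QP: "Q \<star>\<^bsub>N\<^esub> P = Q"
    using AP unfolding Q_def M N by (simp add: einstein_assoc [OF Ui A P])
  have PQ: "P \<star>\<^bsub>N\<^esub> Q = Q"
    using PUi unfolding Q_def M N by (simp add: einstein_assoc [OF P Ui A, symmetric])
  \<comment> \<open>Expanding \<open>C = I - (P - Q)\<close> gives \<open>UC = U - (U - A)\<close>.
    In the same way, \<open>CP\<close> and \<open>PC\<close> both become
    \<open>P - (P - Q)\<close>.\<close>
  have UC: "U \<star>\<^bsub>N\<^esub> C = A"
    using UP UQ unfolding C_def W_eq N
    by (simp add: einstein_minus_right [OF U identity_closed W [unfolded W_eq]] einstein_minus_right [OF U P Q]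
        einstein_identity_right [OF U] minus_minus_cancel [OF U A])
  have CP: "C \<star>\<^bsub>N\<^esub> P = Q"
    using PP QP unfolding C_def W_eq N
    by (simp add: einstein_minus_left [OF identity_closed W [unfolded W_eq] P] einstein_minus_left [OF P Q P]
        einstein_identity_left [OF P] minus_minus_cancel [OF P Q])
  have PC: "P \<star>\<^bsub>N\<^esub> C = Q"
    using PP PQ unfolding C_def W_eq N
    by (simp add: einstein_minus_right [OF P identity_closed W [unfolded W_eq]] einstein_minus_right [OF P P Q]
        einstein_identity_right [OF P] minus_minus_cancel [OF P Q])
  have part1: "tensor_invertible Js C \<and> mp_inverse M N A = tensor_inverse Js C \<star>\<^bsub>N\<^esub> Ui"
    and P_Ai: "P \<star>\<^bsub>N\<^esub> mp_inverse M N A = mp_inverse M N A"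
    if no_ev: "\<not> tensor_eigenvalue Js W 1"
  proof -
    \<comment> \<open>If \<open>CZ = 0\<close> then \<open>WZ = Z\<close>, so a nonzero
      \<open>Z\<close> would be an eigenvector of \<open>W\<close> for the eigenvalue 1.\<close>
    have inv: "tensor_invertible Js C"
    proof (rule tensor_invertible_of_injective [OF C])
      fix Z assume Z: "Z \<in> tensor_space Js" and CZ: "C \<star>\<^bsub>length Js\<^esub> Z = zero_tensor Js"
      have Z': "Z \<in> tensor_space (Js @ [])"
        using Z by simp
      have "Z - W \<star>\<^bsub>length Js\<^esub> Z = zero_tensor (Js @ [])"
        using CZ by (simp add: C_def einstein_minus_left [OF identity_closed W Z'] einstein_identity_left [OF Z'])
      then have "W \<star>\<^bsub>length Js\<^esub> Z = Z"
        using minus_eq_zero_iff [OF Z' einstein_closed [OF W Z']] by simp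
      also have "Z = tensor_scale 1 Z"
        by (intro tensor_eqI) (auto simp: tensor_scale_def entry_mk_tensor)
      finally show "Z = zero_tensor Js"
        using no_ev Z unfolding tensor_eigenvalue_def by blast
    qed
    define D where "D = tensor_inverse Js C"
    have D: "D \<in> tensor_space (Js @ Js)" and CD: "C \<star>\<^bsub>N\<^esub> D = identity_tensor Js"
      and DC: "D \<star>\<^bsub>N\<^esub> C = identity_tensor Js"
      using is_tensor_inverse_tensor_inverse [OF C inv] by (auto simp: is_tensor_inverse_def D_def N)
    define Y where "Y = D \<star>\<^bsub>N\<^esub> Ui"
    have Y: "Y \<in> tensor_space (Js @ Is)"
      unfolding Y_def N by (rule einstein_closed [OF D Ui])
    have DQ: "D \<star>\<^bsub>N\<^esub> Q = P"
      using DC unfolding CP [symmetric] N by (simp add: einstein_assoc [OF D C P, symmetric] einstein_identity_left [OF P])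
    have QD: "Q \<star>\<^bsub>N\<^esub> D = P"
      using CD unfolding PC [symmetric] N by (simp add: einstein_assoc [OF P C D] einstein_identity_right [OF P])
    \<comment> \<open>Both sides equal \<open>DQD\<close>, by \<open>DQ = P\<close> and
      \<open>QD = P\<close>.\<close>
    have PD: "P \<star>\<^bsub>N\<^esub> D = D \<star>\<^bsub>N\<^esub> P"
      using DQ QD unfolding N by (metis einstein_assoc [OF D Q D])
    have AD: "A \<star>\<^bsub>N\<^esub> D = U"
      using CD unfolding UC [symmetric] N by (simp add: einstein_assoc [OF U C D] einstein_identity_right [OF U])
    have AY: "A \<star>\<^bsub>N\<^esub> Y = U \<star>\<^bsub>N\<^esub> Ui"
      using AD unfolding Y_def N by (simp add: einstein_assoc [OF A D Ui, symmetric])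
    have YA: "Y \<star>\<^bsub>M\<^esub> A = P"
      using DQ unfolding Y_def Q_def M N by (simp add: einstein_assoc [OF D Ui A])
    have PY: "P \<star>\<^bsub>N\<^esub> Y = Y"
      using PD PUi unfolding Y_def N
      by (simp add: einstein_assoc [OF P D Ui, symmetric] einstein_assoc [OF D P Ui])
    \<comment> \<open>The products \<open>AY = UU\<^sup>\<dagger>\<close> and \<open>YA = P\<close>
      are Hermitian by the Penrose equations for \<open>U\<close>; \<open>AYA = A\<close> is a
      splitting condition, and \<open>YAY = Y\<close> is \<open>PY = Y\<close>.\<close>
    have "is_mp_inverse M N A Y"
      using Y UUiA PY UUi_herm UiU_herm unfolding M N is_mp_inverse_iff [OF A]
      by (simp add: AY [unfolded M N] YA [unfolded M N] P_def [unfolded M N])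
    then have Ai: "mp_inverse M N A = Y"
      unfolding M N by (rule mp_inverse_eqI [OF A])
    show "tensor_invertible Js C \<and> mp_inverse M N A = tensor_inverse Js C \<star>\<^bsub>N\<^esub> Ui"
      using inv Ai by (simp add: Y_def D_def)
    show "P \<star>\<^bsub>N\<^esub> mp_inverse M N A = mp_inverse M N A"
      by (simp add: Ai PY)
  qed
  \<comment> \<open>With \<open>PX = X\<close>, the first summand is \<open>X - QX\<close> and the
    second is \<open>U\<^sup>\<dagger>AX = QX\<close>.\<close>
  have iteration: "X = W \<star>\<^bsub>N\<^esub> X + Ui \<star>\<^bsub>M\<^esub> (A \<star>\<^bsub>N\<^esub> X)"
    if X: "X \<in> tensor_space Js" and PX: "P \<star>\<^bsub>N\<^esub> X = X" for X
  proof -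
    have X': "X \<in> tensor_space (Js @ [])"
      using X by simp
    have "W \<star>\<^bsub>N\<^esub> X = X - Q \<star>\<^bsub>N\<^esub> X"
      using PX unfolding W_eq N by (simp add: einstein_minus_left [OF P Q X'])
    moreover have "Ui \<star>\<^bsub>M\<^esub> (A \<star>\<^bsub>N\<^esub> X) = Q \<star>\<^bsub>N\<^esub> X"
      unfolding Q_def M N by (rule einstein_assoc [OF Ui A X', symmetric])
    ultimately show ?thesis
      using minus_plus_cancel [OF X' einstein_closed [OF Q X']] by (simp add: N)
  qed
  define Ai where "Ai = mp_inverse M N A"
  have Ai: "Ai \<in> tensor_space (Js @ Is)" and AAiA: "A \<star>\<^bsub>N\<^esub> Ai \<star>\<^bsub>M\<^esub> A = A"
    using is_mp_inverse_mp_inverse [OF A] unfolding is_mp_inverse_iff [OF A] by (auto simp: Ai_def M N)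
  \<comment> \<open>Consistency puts \<open>B = AX\<close> in the range of \<open>A\<close>, where
    \<open>AA\<^sup>\<dagger>\<close> acts as the identity. The last conjunct is conditional because
    \<open>P_Ai\<close> supplies its premise only under the eigenvalue assumption.\<close>
  have solution: "Ai \<star>\<^bsub>M\<^esub> B \<in> tensor_space Js \<and> A \<star>\<^bsub>N\<^esub> (Ai \<star>\<^bsub>M\<^esub> B) = B \<and>
      (P \<star>\<^bsub>N\<^esub> Ai = Ai \<longrightarrow> P \<star>\<^bsub>N\<^esub> (Ai \<star>\<^bsub>M\<^esub> B) = Ai \<star>\<^bsub>M\<^esub> B)"
    if B: "B \<in> tensor_space Is" and X: "X \<in> tensor_space Js" "A \<star>\<^bsub>N\<^esub> X = B" for B X
  proof -
    have B': "B \<in> tensor_space (Is @ [])" and X': "X \<in> tensor_space (Js @ [])"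
      using B X by simp_all
    have "A \<star>\<^bsub>N\<^esub> (Ai \<star>\<^bsub>M\<^esub> B) = A \<star>\<^bsub>N\<^esub> Ai \<star>\<^bsub>M\<^esub> (A \<star>\<^bsub>N\<^esub> X)"
      using einstein_assoc [OF A Ai B'] X(2) by (simp add: M N)
    also have "\<dots> = B"
      using einstein_assoc [OF einstein_closed [OF A Ai] A X'] AAiA X(2) by (simp add: M N)
    finally show ?thesis
      using einstein_closed [OF Ai B'] unfolding M N by (simp add: einstein_assoc [OF P Ai B', symmetric])
  qed
  show ?thesis
    unfolding Ui_def [symmetric] Ai_def [symmetric] W_def [symmetric] C_def [symmetric] P_def [symmetric] Let_def
  proof (intro conjI impI ballI; (elim bexE conjE)?)
    show "A = U \<star>\<^bsub>N\<^esub> C"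
      by (simp add: UC)
    assume no_ev: "\<not> tensor_eigenvalue Js W 1"
    show "tensor_invertible Js C" "Ai = tensor_inverse Js C \<star>\<^bsub>N\<^esub> Ui"
      using part1 [OF no_ev] unfolding Ai_def by blast+
    fix B X assume B: "B \<in> tensor_space Is" and X: "X \<in> tensor_space Js" "A \<star>\<^bsub>N\<^esub> X = B"
    note sol = solution [OF B X]
    show "Ai \<star>\<^bsub>M\<^esub> B \<in> tensor_space Js" "A \<star>\<^bsub>N\<^esub> (Ai \<star>\<^bsub>M\<^esub> B) = B"
      "P \<star>\<^bsub>N\<^esub> (Ai \<star>\<^bsub>M\<^esub> B) = Ai \<star>\<^bsub>M\<^esub> B"
      using sol P_Ai [OF no_ev] unfolding Ai_def by blast+
    fix Z assume "Z \<in> tensor_space Js" "A \<star>\<^bsub>N\<^esub> Z = B" "P \<star>\<^bsub>N\<^esub> Z = Z"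
    then show "Z = W \<star>\<^bsub>N\<^esub> Z + Ui \<star>\<^bsub>M\<^esub> B"
      using iteration by blast
  qed
qed

end
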